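(* For $n, m \geq 2$, $e_{cc}(P_m \Box P_n) \geq m+n-1$.
   Context: $P_k$ is the path on $k$ vertices and $\Box$ the Cartesian product ($(g_1,h_1)\sim(g_2,h_2)$ iff $g_1g_2$ is an edge and $h_1=h_2$, or $g_1=g_2$ and $h_1h_2$ is an edge). Cycle convexity: for $S\subseteq V(X)$, a vertex $v\notin S$ is in the cycle interval of $S$ if $X[S\cup\{v\}]$ contains a cycle through $v$; $S$ is cycle convex if no vertex outside $S$ is in its cycle interval; $\langle S\rangle_{cc}$ is the smallest cycle convex set containing $S$. A nonempty set $S$ is $E$-independent if $|S|=1$ or there exist $p\in S$ and $p'\in \langle S\setminus\{p\}\rangle_{cc}\setminus \bigcup_{a\in S\setminus\{p\}}\langle S\setminus\{a\}\rangle_{cc}$. The exchange number $e_{cc}(X)$ is the maximum cardinality of an $E$-independent set of $X$.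
   Formalization: The case m = n = 2 is excluded, because there the claim is false: P_2 □ P_2 is a 4-cycle, whose exchange number is 2 < 3 = m+n-1; all other m, n ≥ 2 are covered. *)

theory Defs
  imports "Graph_Theory.Graph_Theory"
begin

text \<open>
  Finite simple graphs are represented as in \<^theory>\<open>Graph_Theory.Pair_Digraph\<close>, i.e. by records
  satisfying \<^locale>\<open>pair_graph\<close>: an undirected edge is a symmetric pair of arcs.
\<close>

definition path_graph :: "nat \<Rightarrow> nat pair_pre_digraph" where
  "path_graph k =
    \<lparr> pverts = {..<k},
      parcs = {(i, j). i < k \<and> j < k \<and> (j = Suc i \<or> i = Suc j)} \<rparr>"

definition cart_prod ::
    "'a pair_pre_digraph \<Rightarrow> 'b pair_pre_digraph \<Rightarrow> ('a \<times> 'b) pair_pre_digraph"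
    (infixr \<open>\<box>\<close> 75) where
  "G \<box> H =
    \<lparr> pverts = pverts G \<times> pverts H,
      parcs = {((g1, h1), (g2, h2)).
        g1 \<in> pverts G \<and> g2 \<in> pverts G \<and> h1 \<in> pverts H \<and> h2 \<in> pverts H \<and>
        ((g1, g2) \<in> parcs G \<and> h1 = h2 \<or> g1 = g2 \<and> (h1, h2) \<in> parcs H)} \<rparr>"

text \<open>
  The library's notion of a cycle is the directed one, so a single undirected edge traversed back
  and forth counts as a cycle of length 2. Requiring length at least 3 leaves exactly the cycles of
  the underlying undirected graph.
\<close>

definition cycle_through :: "('a, 'b) pre_digraph \<Rightarrow> 'a \<Rightarrow> bool" where
  "cycle_through G v \<longleftrightarrow>
    (\<exists>c. pre_digraph.cycle G c \<and> 3 \<le> length c \<and> v \<in> tail G ` set c)"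

definition cycle_interval :: "'a pair_pre_digraph \<Rightarrow> 'a set \<Rightarrow> 'a set" where
  "cycle_interval X S = {v \<in> pverts X - S. cycle_through (with_proj X \<restriction> (S \<union> {v})) v}"

definition cycle_convex :: "'a pair_pre_digraph \<Rightarrow> 'a set \<Rightarrow> bool" where
  "cycle_convex X S \<longleftrightarrow> S \<subseteq> pverts X \<and> cycle_interval X S = {}"

definition cc_hull :: "'a pair_pre_digraph \<Rightarrow> 'a set \<Rightarrow> 'a set" where
  "cc_hull X S = \<Inter> {C. cycle_convex X C \<and> S \<subseteq> C}"

definition E_independent :: "'a pair_pre_digraph \<Rightarrow> 'a set \<Rightarrow> bool" where
  "E_independent X S \<longleftrightarrow>
    S \<subseteq> pverts X \<and> S \<noteq> {} \<and>
    (card S = 1 \<or>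
     (\<exists>p \<in> S. \<exists>p'. p' \<in> cc_hull X (S - {p}) - (\<Union>a \<in> S - {p}. cc_hull X (S - {a}))))"

definition exchange_number :: "'a pair_pre_digraph \<Rightarrow> nat" where
  "exchange_number X = Max {card S | S. E_independent X S}"

lemma pair_graph_path_graph: "pair_graph (path_graph k)"
proof
  show "finite (parcs (path_graph k))"
    by (rule finite_subset[of _ "{..<k} \<times> {..<k}"]) (auto simp: path_graph_def)
qed (auto simp: path_graph_def symmetric_def sym_def)

lemma pair_graph_cart_prod:
  assumes "pair_graph G" "pair_graph H"
  shows "pair_graph (G \<box> H)"
proof -
  interpret G: pair_graph G by fact
  interpret H: pair_graph H by fact
  have symG: "(b, a) \<in> parcs G" if "(a, b) \<in> parcs G" for a b
    using G.sym_arcs that by (auto simp: symmetric_def sym_def)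
  have symH: "(b, a) \<in> parcs H" if "(a, b) \<in> parcs H" for a b
    using H.sym_arcs that by (auto simp: symmetric_def sym_def)
  show ?thesis
  proof
    have "sym (parcs (G \<box> H))"
      by (rule symI) (auto simp: cart_prod_def intro: symG symH)
    then show "symmetric (with_proj (G \<box> H))" by (simp add: symmetric_def)
    show "fst e \<noteq> snd e" if "e \<in> parcs (G \<box> H)" for e
      using that G.pair_no_loops H.pair_no_loops by (fastforce simp: cart_prod_def)
    show "finite (pverts (G \<box> H))" by (simp add: cart_prod_def)
    show "finite (parcs (G \<box> H))"
      by (rule finite_subset[of _ "(pverts G \<times> pverts H) \<times> (pverts G \<times> pverts H)"])
        (auto simp: cart_prod_def)
  qed (auto simp: cart_prod_def)
qed

lemma subset_cc_hull: "S \<subseteq> cc_hull X S"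
  by (auto simp: cc_hull_def)

lemma cc_hull_minimal: "cycle_convex X C \<Longrightarrow> S \<subseteq> C \<Longrightarrow> cc_hull X S \<subseteq> C"
  by (auto simp: cc_hull_def)

lemma cycle_convex_pverts: "cycle_convex X (pverts X)"
  by (auto simp: cycle_convex_def cycle_interval_def)

lemma cycle_through_induce_mono:
  assumes "cycle_through (with_proj X \<restriction> A) v" "A \<subseteq> B"
  shows "cycle_through (with_proj X \<restriction> B) v"
proof -
  have cas: "pre_digraph.cas (with_proj X \<restriction> C) = pcas" for C
    unfolding fun_eq_iff
  proof (intro allI)
    show "pre_digraph.cas (with_proj X \<restriction> C) u es w = pcas u es w" for u es w
      by (induct es arbitrary: u) (auto simp: pre_digraph.cas.simps)
  qed
  have verts: "pre_digraph.awalk_verts (with_proj X \<restriction> C) = pawalk_verts" for C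
    unfolding fun_eq_iff
  proof (intro allI)
    show "pre_digraph.awalk_verts (with_proj X \<restriction> C) u es = pawalk_verts u es" for u es
      by (induct es arbitrary: u) (auto simp: pre_digraph.awalk_verts.simps)
  qed
  from assms show ?thesis
    unfolding cycle_through_def pre_digraph.cycle_def pre_digraph.awalk_def cas verts
    by simp blast
qed

lemma cycle_convex_cc_hull:
  assumes "S \<subseteq> pverts X"
  shows "cycle_convex X (cc_hull X S)"
proof -
  have sub: "cc_hull X S \<subseteq> pverts X"
    by (rule cc_hull_minimal[OF cycle_convex_pverts assms])
  have False if v: "v \<in> cycle_interval X (cc_hull X S)" for v
  proof -
    from v obtain C where C: "cycle_convex X C" "S \<subseteq> C" "v \<notin> C"
      by (auto simp: cycle_interval_def cc_hull_def)
    have "cc_hull X S \<union> {v} \<subseteq> C \<union> {v}"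
      using cc_hull_minimal[OF C(1,2)] by blast
    with v have "cycle_through (with_proj X \<restriction> (C \<union> {v})) v"
      using cycle_through_induce_mono by (fastforce simp: cycle_interval_def)
    with v C show False
      by (auto simp: cycle_interval_def cycle_convex_def)
  qed
  with sub show ?thesis
    by (auto simp: cycle_convex_def)
qed

lemma grid_cycle_interval_card:
  assumes v: "v \<in> cycle_interval (path_graph m \<box> path_graph n) S"
    and fin: "finite S"
  shows "3 \<le> card S"
proof -
  let ?X = "path_graph m \<box> path_graph n"
  define B where "B = S \<union> {v}"
  let ?G = "with_proj ?X \<restriction> B"
  from v have "cycle_through ?G v" and cardB: "card B = Suc (card S)" "finite B"
    using fin by (auto simp: cycle_interval_def B_def)
  then obtain c u where c: "pre_digraph.awalk ?G u c u"
      "distinct (tl (pre_digraph.awalk_verts ?G u c))" "3 \<le> length c"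
    unfolding cycle_through_def pre_digraph.cycle_def by blast
  interpret X: pair_graph ?X
    by (intro pair_graph_cart_prod pair_graph_path_graph)
  interpret G: wf_digraph ?G
    by unfold_locales auto
  have walk: "u \<in> B" "set c \<subseteq> arcs ?G" "G.cas u c u"
    using c(1) by (simp_all add: G.awalk_def)
  have "set (G.awalk_verts u c) \<subseteq> B"
    using walk G.awalk_verts_in_verts[of u c] by fastforce
  then have "set (tl (G.awalk_verts u c)) \<subseteq> B"
    by (cases "G.awalk_verts u c") auto
  then have "card (set (tl (G.awalk_verts u c))) \<le> card B"
    using cardB(2) by (rule card_mono[rotated])
  then have len: "length c \<le> Suc (card S)"
    using c(2) cardB(1) by (simp add: distinct_card G.length_awalk_verts)
  have parity: "odd (a + b + (a' + b'))" if "((a, b), (a', b')) \<in> parcs ?X" for a b a' b'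
    using that by (auto simp: cart_prod_def path_graph_def)
  have "length c \<noteq> 3"
  proof
    assume "length c = 3"
    then obtain e1 e2 e3 where "c = [e1, e2, e3]"
      by (auto simp: numeral_3_eq_3 length_Suc_conv)
    moreover obtain a1 b1 a2 b2 a3 b3 where
      "fst e1 = (a1, b1)" "fst e2 = (a2, b2)" "fst e3 = (a3, b3)"
      by (meson surj_pair)
    ultimately have "((a1, b1), (a2, b2)) \<in> parcs ?X" "((a2, b2), (a3, b3)) \<in> parcs ?X"
        "((a3, b3), (a1, b1)) \<in> parcs ?X"
      using walk(2,3) by (cases e1; cases e2; cases e3; simp)+
    then have "odd (a1 + b1 + (a2 + b2))" "odd (a2 + b2 + (a3 + b3))" "odd (a3 + b3 + (a1 + b1))"
      by (blast dest: parity)+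
    then show False by (simp; argo)
  qed
  with len c(3) show ?thesis by simp
qed

text \<open>
  The grid on \<open>2 \<times> 2\<close> vertices is a 4-cycle. Sets of two vertices are cycle convex there, so no set
  of three vertices is E-independent, and the bound \<open>m + n - 1\<close> fails for \<open>m = n = 2\<close>.
\<close>

lemma exchange_number_grid_2_2: "exchange_number (path_graph 2 \<box> path_graph 2) < 2 + 2 - 1"
proof -
  let ?X = "path_graph 2 \<box> path_graph 2"
  have fin: "finite (pverts ?X)" and card4: "card (pverts ?X) = 4"
    by (auto simp: cart_prod_def path_graph_def card_cartesian_product)
  have le2: "card S \<le> 2" if S: "E_independent ?X S" for S
  proof (rule ccontr)
    assume gt: "\<not> card S \<le> 2"
    from S have SV: "S \<subseteq> pverts ?X" by (simp add: E_independent_def)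
    then have finS: "finite S" using fin finite_subset by blast
    have "card S \<noteq> 1" using gt by simp
    with S obtain p p' where p: "p \<in> S" "p' \<in> cc_hull ?X (S - {p})"
        and p': "\<And>a. a \<in> S - {p} \<Longrightarrow> p' \<notin> cc_hull ?X (S - {a})"
      unfolding E_independent_def by blast
    have card_p: "card (S - {p}) \<ge> 2" using gt p(1) finS by simp
    have "p' \<notin> S"
    proof
      assume "p' \<in> S"
      have "\<not> S - {p} \<subseteq> {p'}"
        using card_p card_mono[of "{p'}" "S - {p}"] by auto
      then obtain a where "a \<in> S - {p}" "a \<noteq> p'" by blast
      with p'[of a] \<open>p' \<in> S\<close> subset_cc_hull[of "S - {a}" ?X] show False by auto
    qed
    have "p' \<in> pverts ?X"
      using cc_hull_minimal[OF cycle_convex_pverts, of "S - {p}" ?X] SV p(2) by blast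
    with \<open>p' \<notin> S\<close> SV have "card S < 4"
      using psubset_card_mono[OF fin, of S] card4 by auto
    then have "card (S - {p}) < 3" using p(1) finS by simp
    then have "v \<notin> cycle_interval ?X (S - {p})" for v
      using grid_cycle_interval_card[of v 2 2 "S - {p}"] finS by auto
    then have "cycle_interval ?X (S - {p}) = {}" by blast
    then have "cycle_convex ?X (S - {p})"
      using SV by (auto simp: cycle_convex_def)
    then have "p' \<in> S" using cc_hull_minimal p(2) by blast
    with \<open>p' \<notin> S\<close> show False ..
  qed
  have "E_independent ?X {(0, 0)}"
    by (auto simp: E_independent_def cart_prod_def path_graph_def)
  then have "{card S | S. E_independent ?X S} \<noteq> {}" by blast
  moreover have sub: "{card S | S. E_independent ?X S} \<subseteq> {..2}"
    using le2 by (simp add: subset_iff) blast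
  moreover have "finite {card S | S. E_independent ?X S}"
    using sub finite_atMost by (rule finite_subset)
  ultimately have "Max {card S | S. E_independent ?X S} \<in> {..2}"
    using Max_in by (meson subsetD)
  then show ?thesis by (simp add: exchange_number_def)
qed

end

theory Submission
  imports Defs
begin

text \<open>
  Let \<open>S\<close> be the union of the first row and the first column of the grid, which has \<open>m + n - 1\<close>
  vertices. Closing up 4-cycles one by one, row \<open>0\<close> up to column \<open>j\<close> and column \<open>0\<close> up to row \<open>i\<close>
  generate the whole rectangle with opposite corner \<open>(i, j)\<close>. So removing an end \<open>p\<close> of the L-shape
  \<open>S\<close> still yields all but one row or column of the grid, in particular the corner \<open>p'\<close> of that
  smaller rectangle. For any other vertex \<open>a\<close> of \<open>S\<close>, the hull of \<open>S - {a}\<close> is contained in the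
  union of a thinner rectangle and a (possibly empty) line segment not adjacent to it. This union is
  convex, as every outside vertex has at most one neighbour in either part, and it misses \<open>p'\<close>.
  If \<open>n \<ge> 3\<close>, then \<open>p = (0, n - 1)\<close> works; otherwise \<open>m \<ge> 3\<close> and \<open>p = (m - 1, 0)\<close> works.
\<close>

lemma (in wf_digraph) awalk_colour_constant:
  assumes "awalk x d y" "x \<in> C" "head G ` set d \<subseteq> C"
    and "\<And>a. a \<in> arcs G \<Longrightarrow> tail G a \<in> C \<Longrightarrow> head G a \<in> C \<Longrightarrow> f (tail G a) = f (head G a)"
  shows "f x = f y"
  using assms(1-3)
proof (induct d arbitrary: x)
  case Nil
  then show ?case by (simp add: awalk_Nil_iff)
next
  case (Cons a d)
  then show ?case using assms(4)[of a] by (auto simp: awalk_Cons_iff)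
qed

text \<open>Rotating the cycle puts the arc \<open>e\<close> leaving \<open>v\<close> first and the
  arc \<open>g\<close> returning to \<open>v\<close> last. Length at least 3 keeps the walk
  \<open>d\<close> between them nonempty, so distinct heads force two different neighbours of
  \<open>v\<close>.\<close>

lemma (in wf_digraph) cycle_through_neighboursE:
  assumes "cycle_through G v"
  obtains e d g where "e \<in> arcs G" "g \<in> arcs G" "tail G e = v" "head G g = v"
    "head G e \<noteq> tail G g" "awalk (head G e) d (tail G g)"
    "v \<notin> insert (head G e) (head G ` set d)"
proof -
  from assms obtain c u where c: "awalk u c u" "distinct (tl (awalk_verts u c))" "3 \<le> length c"
      "v \<in> tail G ` set c"
    unfolding cycle_through_def cycle_def by blast
  then obtain c1 e c2 where split: "c = c1 @ e # c2" and e: "tail G e = v"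
    by (metis imageE split_list)
  have walk: "awalk u c1 v" "e \<in> arcs G" "awalk (head G e) c2 u"
    using c(1) e by (auto simp: split awalk_Cons_iff)
  have "cas u c u" using c(1) by (simp add: awalk_def)
  with c have dist: "distinct (map (head G) c)"
    by (auto simp: awalk_verts_conv' split: if_splits)
  have closed: "awalk (head G e) (c2 @ c1) v"
    using walk by (blast intro: awalk_appendI)
  have "2 \<le> length (c2 @ c1)" using c(3) by (simp add: split)
  then obtain d g where dg: "c2 @ c1 = d @ [g]" "d \<noteq> []"
    by (cases "c2 @ c1" rule: rev_cases) (auto simp: Suc_le_eq)
  from closed have g: "awalk (head G e) d (tail G g)" "g \<in> arcs G" "head G g = v"
    unfolding dg by (auto simp: awalk_Cons_iff awalk_Nil_iff)
  have "distinct (head G e # map (head G) (c2 @ c1))"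
    using dist by (auto simp: split)
  then have dist': "distinct (head G e # map (head G) d @ [v])"
    unfolding dg using g(3) by simp
  have "tail G g = head G (last d)"
    using g(1) dg(2) by (metis awalk_verts_conv awalkE' last_snoc)
  moreover have "head G (last d) \<in> head G ` set d" using dg(2) by simp
  ultimately have "head G e \<noteq> tail G g" using dist' by auto
  with that[of e g d] g walk(2) e dist' show thesis by auto
qed

text \<open>
  The colouring \<open>f\<close> separates groups of connected components of \<open>C\<close>: a vertex outside \<open>C\<close> closes no
  cycle when its neighbours in \<open>C\<close> have pairwise different colours.
\<close>

lemma cycle_convex_colouringI:
  assumes X: "pair_wf_digraph X" and sub: "C \<subseteq> pverts X"
    and const: "\<And>x y. \<lbrakk>x \<in> C; y \<in> C; (x, y) \<in> parcs X\<rbrakk> \<Longrightarrow> f x = f y"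
    and sep: "\<And>v x y. \<lbrakk>v \<in> pverts X - C; x \<in> C; y \<in> C; (v, x) \<in> parcs X; (y, v) \<in> parcs X;
      f x = f y\<rbrakk> \<Longrightarrow> x = y"
  shows "cycle_convex X C"
proof -
  have False if v: "v \<in> cycle_interval X C" for v
  proof -
    let ?G = "with_proj X \<restriction> insert v C"
    interpret X: pair_wf_digraph X by fact
    interpret G: wf_digraph ?G
      by unfold_locales auto
    from v have vC: "v \<in> pverts X - C" and "cycle_through ?G v"
      by (auto simp: cycle_interval_def)
    from this(2) obtain e d g where eg: "e \<in> arcs ?G" "g \<in> arcs ?G" "fst e = v" "snd g = v"
        "snd e \<noteq> fst g" and d: "G.awalk (snd e) d (fst g)" "v \<notin> insert (snd e) (snd ` set d)"
      by (rule G.cycle_through_neighboursE) simp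
    \<comment> \<open>The walk avoids \<open>v\<close>, hence stays in \<open>C\<close>, so both
      neighbours of \<open>v\<close> on the cycle get the same colour.\<close>
    have "snd e \<in> insert v C" "snd ` set d \<subseteq> insert v C"
      using eg(1) d(1) by (auto simp: G.awalk_def)
    with d(2) have heads: "snd e \<in> C" "snd ` set d \<subseteq> C"
      by blast+
    have "f (snd e) = f (fst g)"
      by (rule G.awalk_colour_constant[OF d(1), of C]) (use heads const in auto)
    moreover have "fst g \<in> C"
    proof -
      have "fst g = snd e \<or> fst g \<in> snd ` set d"
        using d(1) by (cases d rule: rev_cases) (auto simp: G.awalk_Cons_iff G.awalk_Nil_iff)
      then show ?thesis using heads by auto
    qed
    moreover have "(v, snd e) \<in> parcs X" "(fst g, v) \<in> parcs X"
      using eg(1-4) by (cases e; cases g; simp)+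
    ultimately show False using sep[OF vC heads(1)] eg(5) by blast
  qed
  with sub show ?thesis by (auto simp: cycle_convex_def)
qed

lemma cycle_convex_4_cycle:
  assumes conv: "cycle_convex X C" and "v \<in> pverts X" "x \<in> C" "y \<in> C" "z \<in> C"
    and arcs: "(v, x) \<in> parcs X" "(x, y) \<in> parcs X" "(y, z) \<in> parcs X" "(z, v) \<in> parcs X"
    and "distinct [v, x, y, z]"
  shows "v \<in> C"
proof (rule ccontr)
  assume "v \<notin> C"
  let ?G = "with_proj X \<restriction> (C \<union> {v})"
  have "pre_digraph.cycle ?G [(v, x), (x, y), (y, z), (z, v)]"
    unfolding pre_digraph.cycle_def pre_digraph.awalk_def
    using assms by (auto simp: pre_digraph.cas.simps pre_digraph.awalk_verts.simps)
  then have "cycle_through ?G v"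
    unfolding cycle_through_def by force
  with \<open>v \<notin> C\<close> assms show False
    by (auto simp: cycle_convex_def cycle_interval_def)
qed

abbreviation grid :: "nat \<Rightarrow> nat \<Rightarrow> (nat \<times> nat) pair_pre_digraph" where
  "grid m n \<equiv> path_graph m \<box> path_graph n"

lemma pverts_grid [simp]: "pverts (grid m n) = {..<m} \<times> {..<n}"
  by (simp add: cart_prod_def path_graph_def)

lemma parcs_grid_iff:
  "((i, j), (k, l)) \<in> parcs (grid m n) \<longleftrightarrow>
    i < m \<and> k < m \<and> j < n \<and> l < n \<and>
    ((k = Suc i \<or> i = Suc k) \<and> j = l \<or> i = k \<and> (l = Suc j \<or> j = Suc l))"
  by (auto simp: cart_prod_def path_graph_def)

lemma pair_wf_digraph_grid: "pair_wf_digraph (grid m n)"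
proof -
  interpret pair_graph "grid m n"
    by (intro pair_graph_cart_prod pair_graph_path_graph)
  show ?thesis by unfold_locales
qed

lemma cycle_convex_grid_rectangle:
  assumes conv: "cycle_convex (grid m n) C"
    and row: "\<And>j. j \<le> b \<Longrightarrow> (0, j) \<in> C" and col: "\<And>i. i \<le> a \<Longrightarrow> (i, 0) \<in> C"
    and "i \<le> a" "j \<le> b" "a < m" "b < n"
  shows "(i, j) \<in> C"
  using \<open>i \<le> a\<close> \<open>j \<le> b\<close>
proof (induct i arbitrary: j)
  case 0
  then show ?case by (simp add: row)
next
  case (Suc i)
  from Suc.prems(2) show ?case
  proof (induct j)
    case 0
    then show ?case using Suc.prems by (simp add: col)
  next
    case (Suc j)
    \<comment> \<open>The outer induction supplies the two corners in row \<open>i\<close>, the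
      inner one supplies \<open>(Suc i, j)\<close>.\<close>
    then show ?case
      using Suc.hyps \<open>Suc i \<le> a\<close> \<open>a < m\<close> \<open>b < n\<close> \<open>\<And>j. i \<le> a \<Longrightarrow> j \<le> b \<Longrightarrow> (i, j) \<in> C\<close>
      by (intro cycle_convex_4_cycle[OF conv, of "(Suc i, Suc j)" "(i, Suc j)" "(i, j)" "(Suc i, j)"])
        (auto simp: parcs_grid_iff)
  qed
qed

definition L_shape :: "nat \<Rightarrow> nat \<Rightarrow> (nat \<times> nat) set" where
  "L_shape m n = {(i, j). i < m \<and> j < n \<and> (i = 0 \<or> j = 0)}"

lemma L_shape_subset: "L_shape m n \<subseteq> pverts (grid m n)"
  by (auto simp: L_shape_def)

lemma card_L_shape:
  assumes "0 < m" "0 < n"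
  shows "card (L_shape m n) = m + n - 1"
proof -
  have "L_shape m n = (\<lambda>j. (0, j)) ` {..<n} \<union> (\<lambda>i. (i, 0)) ` {1..<m}"
    using assms by (auto simp: L_shape_def image_iff)
  also have "card \<dots> = n + (m - 1)"
    by (subst card_Un_disjoint) (auto simp: card_image inj_on_def)
  finally show ?thesis using assms by simp
qed

text \<open>Without the corner the two arms are not adjacent. Only \<open>(0, 0)\<close> and
  \<open>(1, 1)\<close> can be adjacent to both from outside, and each has at most one neighbour on
  either arm.\<close>

lemma cc_hull_L_shape_minus_corner:
  "cc_hull (grid m n) (L_shape m n - {(0, 0)}) \<subseteq> L_shape m n - {(0, 0)}"
  by (rule cc_hull_minimal[OF
        cycle_convex_colouringI[where f = "\<lambda>x. fst x = 0", OF pair_wf_digraph_grid]])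
    (auto simp: L_shape_def parcs_grid_iff)

text \<open>The colour tells the block of columns before \<open>j\<close> from the segment of row 0
  after \<open>j\<close>; only \<open>(0, j)\<close> can be adjacent to both.\<close>

lemma cc_hull_L_shape_minus_row_vertex:
  assumes "0 < j"
  shows "cc_hull (grid m n) (L_shape m n - {(0, j)})
    \<subseteq> {(k, l). k < m \<and> l < n \<and> (l < j \<or> k = 0 \<and> j < l)}"
  by (rule cc_hull_minimal[OF
        cycle_convex_colouringI[where f = "\<lambda>x. snd x < j", OF pair_wf_digraph_grid]])
    (use assms in \<open>auto simp: L_shape_def parcs_grid_iff\<close>)

lemma cc_hull_L_shape_minus_column_vertex:
  assumes "0 < i"
  shows "cc_hull (grid m n) (L_shape m n - {(i, 0)})
    \<subseteq> {(k, l). k < m \<and> l < n \<and> (k < i \<or> l = 0 \<and> i < k)}"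
  by (rule cc_hull_minimal[OF
        cycle_convex_colouringI[where f = "\<lambda>x. fst x < i", OF pair_wf_digraph_grid]])
    (use assms in \<open>auto simp: L_shape_def parcs_grid_iff\<close>)

lemma E_independent_L_shape:
  assumes "m \<ge> 2" and "n \<ge> 2" and "(m, n) \<noteq> (2, 2)"
  shows "E_independent (grid m n) (L_shape m n)"
proof -
  \<comment> \<open>\<open>0 < i\<close> and \<open>0 < j\<close> keep \<open>(i, j)\<close> off the
    L-shape. In the 2 by 2 grid either choice of \<open>p\<close> would violate this.\<close>
  obtain p i j where p: "p \<in> L_shape m n"
    and ij: "i < m" "j < n" "0 < i" "0 < j"
    and p_cases: "p = (0, n - 1) \<and> i = m - 1 \<and> j = n - 2 \<or>
      p = (m - 1, 0) \<and> i = m - 2 \<and> j = n - 1"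
  proof (cases "n = 2")
    case True
    then show thesis using assms
      by (intro that[of "(m - 1, 0)" "m - 2" "n - 1"]) (auto simp: L_shape_def)
  next
    case False
    then show thesis using assms
      by (intro that[of "(0, n - 1)" "m - 1" "n - 2"]) (auto simp: L_shape_def)
  qed
  have "L_shape m n - {p} \<subseteq> pverts (grid m n)"
    using L_shape_subset by blast
  then have conv: "cycle_convex (grid m n) (cc_hull (grid m n) (L_shape m n - {p}))"
    by (rule cycle_convex_cc_hull)
  have "(i, j) \<in> cc_hull (grid m n) (L_shape m n - {p})"
    by (rule cycle_convex_grid_rectangle[OF conv, of j i])
      (use ij p_cases in \<open>auto simp: L_shape_def intro!: subsetD[OF subset_cc_hull]\<close>)
  moreover have "(i, j) \<notin> cc_hull (grid m n) (L_shape m n - {a})"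
    if a: "a \<in> L_shape m n - {p}" for a
  proof -
    consider "a = (0, 0)" | l where "a = (0, l)" "0 < l" "l < n"
      | k where "a = (k, 0)" "0 < k" "k < m"
      using a by (auto simp: L_shape_def)
    then show ?thesis
    proof cases
      case 1
      moreover have "(i, j) \<notin> L_shape m n" using ij by (simp add: L_shape_def)
      ultimately show ?thesis
        using cc_hull_L_shape_minus_corner by blast
    next
      case 2
      \<comment> \<open>If \<open>j = n - 2\<close>, then \<open>a \<noteq> p\<close> excludes
        \<open>l = n - 1\<close>. Hence \<open>(i, j)\<close> is neither left of column
        \<open>l\<close> nor in row 0.\<close>
      then have "l \<le> j" using a p_cases by auto
      with 2 show ?thesis
        using cc_hull_L_shape_minus_row_vertex[of l m n] ij by auto
    next
      case 3
      then have "k \<le> i" using a p_cases by auto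
      with 3 show ?thesis
        using cc_hull_L_shape_minus_column_vertex[of k m n] ij by auto
    qed
  qed
  ultimately show ?thesis
    unfolding E_independent_def using p L_shape_subset by blast
qed

lemma card_le_exchange_number:
  assumes "finite (pverts X)" and "E_independent X S"
  shows "card S \<le> exchange_number X"
proof -
  have "{card S | S. E_independent X S} \<subseteq> card ` Pow (pverts X)"
    by (auto simp: E_independent_def)
  then have "finite {card S | S. E_independent X S}"
    using assms(1) by (simp add: finite_subset)
  then show ?thesis
    unfolding exchange_number_def using assms(2) by (intro Max_ge) auto
qed

theorem theorem7:
  fixes m n :: nat
  assumes "m \<ge> 2" and "n \<ge> 2" and "(m, n) \<noteq> (2, 2)"
  shows "exchange_number (path_graph m \<box> path_graph n) \<ge> m + n - 1"
  using card_le_exchange_number[OF _ E_independent_L_shape[OF assms]] assms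
  by (simp add: card_L_shape)

end
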